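(* (Blame-Subtyping Theorem for EDI$'$.) Let $M:\Gamma\vdash' A$ be a term of EDI$'$ and $\ell$ a blame label. If $M$ is safe for $\ell$, then it is not the case that $M\longrightarrow^{*}\mathtt{blame}\,\ell$.
   Context: EDI$'$ is a cast calculus with partially-eager "D" casts in which cross casts are inert. **Types.** Base types $b$: $\mathtt{Nat},\mathtt{Bool},\mathtt{Int},\mathtt{Unit},\bot$. Types: $A,B::=b\mid\,?\mid A\to B\mid A\times B\mid A+B$; atomic types $a::=b\mid\,?$; $\otimes$ ranges over $\{\to,\times,+\}$. Contexts are finite sequences of types; variables are de Bruijn indices (index $0$ is the last-added type). Primitive types $P::=b\mid b\to P$; each $b$ denotes a set (naturals, Booleans, integers, one-element set, empty set), $[\![b\to P]\!]$ is the set of functions $[\![b]\!]\to[\![P]\!]$. Blame labels range over a fixed set. *Consistency* $\sim$: $A\sim\,?$; $?\sim B$; $b\sim b$; $A\otimes B\sim A'\otimes B'$ if $A\sim A'$, $B\sim B'$. **Casts**: $c=(A\Rightarrow^\ell B)$ with $A\sim B$, a cast from $A$ to $B$. *Inert*: $A\Rightarrow^\ell\,?$ with $A\neq\,?$, and $A\otimes B\Rightarrow^\ell C\otimes D$. *Active*: $a\Rightarrow^\ell a$; $?\Rightarrow^\ell B$ with $B\neq\,?$. **Terms** (intrinsically typed; $M:\Gamma\vdash' A$): $\$k:P$ for $k\in[\![P]\!]$; $`x:A$ if $x$ has type $A$ in $\Gamma$; $\lambda M:A\to B$ if $M:\Gamma\cdot A\vdash' B$; $L\,M:B$ if $L:A\to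 B$, $M:A$; $\mathtt{if}\,L\,M\,N:B$ if $L:\mathtt{Bool}$, $M,N:B$; $\mathtt{cons}\,M\,N:A\times B$; $\pi_iM:A_i$ if $M:A_1\times A_2$; $\mathtt{inl}[B]M:A+B$ if $M:A$; $\mathtt{inr}[A]M:A+B$ if $M:B$; $\mathtt{case}\,L\,M\,N:B$ if $L:\Gamma\vdash' A_1+A_2$, $M:\Gamma\cdot A_1\vdash' B$, $N:\Gamma\cdot A_2\vdash' B$; $M\langle c\rangle:B$ if $M:A$ and $c$ is a cast from $A$ to $B$; $M\langle\!\langle c\rangle\!\rangle:B$ likewise with $c$ inert; $\mathtt{blame}\,\ell:A$ for every $A$. **Values** $V,W$: $\lambda M$; $\$k$; $\mathtt{cons}\,V\,W$; $\mathtt{inl}[B]V$; $\mathtt{inr}[A]V$; $V\langle\!\langle c\rangle\!\rangle$. **Frames** $F$: $\Box\,M$; $V\,\Box$; $\mathtt{if}\,\Box\,M\,N$; $\mathtt{cons}\,V\,\Box$; $\mathtt{cons}\,\Box\,N$; $\pi_i\Box$; $\mathtt{inl}[B]\Box$; $\mathtt{inr}[A]\Box$; $\mathtt{case}\,\Box\,M\,N$; $\Box\langle c\rangle$; $\Box\langle\!\langle c\rangle\!\rangle$. **Reduction** ($M[N]$ is substitution for variable $0$): - $F[M]\longrightarrow F[M']$ if $M\longrightarrow M'$; $F[\mathtt{blame}\,\ell]\longrightarrow\mathtt{blame}\,\ell$. - $V\langle c\rangle\longrightarrow V\langle\!\langle c\rangle\!\rangle$ for $c$ inert; $V\langle a\Rightarrow^\ell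 a\rangle\longrightarrow V$. - $V\langle\!\langle A\Rightarrow^{\ell_1}?\rangle\!\rangle\langle?\Rightarrow^{\ell_2}B\rangle\longrightarrow V\langle A\Rightarrow^{\ell_2}B\rangle$ if $A\sim B$, and $\longrightarrow\mathtt{blame}\,\ell_2$ otherwise ($B\ne\,?$). - $V\langle\!\langle A\to B\Rightarrow^\ell C\to D\rangle\!\rangle\,W\longrightarrow(V\,(W\langle C\Rightarrow^\ell A\rangle))\langle B\Rightarrow^\ell D\rangle$. - $\pi_1(V\langle\!\langle A\times B\Rightarrow^\ell C\times D\rangle\!\rangle)\longrightarrow(\pi_1V)\langle A\Rightarrow^\ell C\rangle$; $\pi_2(V\langle\!\langle A\times B\Rightarrow^\ell C\times D\rangle\!\rangle)\longrightarrow(\pi_2V)\langle B\Rightarrow^\ell D\rangle$. - $\mathtt{case}\,(V\langle\!\langle A+B\Rightarrow^\ell C+D\rangle\!\rangle)\,M\,N\longrightarrow\mathtt{case}\,V\,M'\,N'$, where $M'$ is $M$ with its bound variable $`0$ replaced by $`0\langle A\Rightarrow^\ell C\rangle$ and $N'$ is $N$ with its bound variable $`0$ replaced by $`0\langle B\Rightarrow^\ell D\rangle$. - $(\lambda M)V\longrightarrow M[V]$; $\mathtt{if}\,\$\mathtt{true}\,M\,N\longrightarrow M$; $\mathtt{if}\,\$\mathtt{false}\,M\,N\longrightarrow N$; $\pi_1(\mathtt{cons}\,V\,W)\longrightarrow V$; $\pi_2(\mathtt{cons}\,V\,W)\longrightarrow W$; $\mathtt{case}(\mathtt{inl}[B]V)\,M\,N\longrightarrow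 M[V]$; $\mathtt{case}(\mathtt{inr}[A]V)\,M\,N\longrightarrow N[V]$; $\$k\,\$k'\longrightarrow\$(k(k'))$. $\longrightarrow^{*}$ is the reflexive-transitive closure. **Subtyping** ("D"): $A<:\,?$; $b<:b$; $A\to B<:C\to D$ if $C<:A$ and $B<:D$; $A\times B<:C\times D$ and $A+B<:C+D$ if $A<:C$ and $B<:D$. **Blame safety.** $\mathsf{CastBlameSafe}\,(A\Rightarrow^{\ell'}B)\,\ell$ holds iff $\ell'\neq\ell$ or $A<:B$. $M$ is *safe for* $\ell$ iff every cast $c$ occurring in $M$ (in a subterm $N\langle c\rangle$ or $N\langle\!\langle c\rangle\!\rangle$) satisfies $\mathsf{CastBlameSafe}\,c\,\ell$ and every subterm $\mathtt{blame}\,\ell'$ of $M$ has $\ell'\neq\ell$. *)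

theory Defs
  imports "HOL-Library.FuncSet"
begin

section \<open>Types, primitive types and constants\<close>

datatype base = BNat | BBool | BInt | BUnit | BBot

datatype ty =
    Base base
  | Dyn
  | Fun ty ty
  | Prod ty ty
  | Sum ty ty

datatype prim = PBase base | PFun base prim

primrec ty_of_prim :: "prim \<Rightarrow> ty" where
  "ty_of_prim (PBase b) = Base b"
| "ty_of_prim (PFun b P) = Fun (Base b) (ty_of_prim P)"

datatype base_val = NatV nat | BoolV bool | IntV int | UnitV

datatype prim_val = BaseV base_val | FunV "base_val \<Rightarrow> prim_val"

primrec base_den :: "base \<Rightarrow> base_val set" where
  "base_den BNat = range NatV"
| "base_den BBool = range BoolV"
| "base_den BInt = range IntV"
| "base_den BUnit = {UnitV}"
| "base_den BBot = {}"

text \<open>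
  The denotation of \<open>b \<rightarrow> P\<close> is the full function space. HOL functions are total, so a function on
  the denotation of \<open>b\<close> is represented by its unique extension that is \<open>undefined\<close> elsewhere.
\<close>

primrec prim_den :: "prim \<Rightarrow> prim_val set" where
  "prim_den (PBase b) = BaseV ` base_den b"
| "prim_den (PFun b P) = FunV ` (base_den b \<rightarrow>\<^sub>E prim_den P)"

inductive consistent :: "ty \<Rightarrow> ty \<Rightarrow> bool" (infix "\<sim>" 50) where
  "A \<sim> Dyn"
| "Dyn \<sim> B"
| "Base b \<sim> Base b"
| "A \<sim> A' \<Longrightarrow> B \<sim> B' \<Longrightarrow> Fun A B \<sim> Fun A' B'"
| "A \<sim> A' \<Longrightarrow> B \<sim> B' \<Longrightarrow> Prod A B \<sim> Prod A' B'"
| "A \<sim> A' \<Longrightarrow> B \<sim> B' \<Longrightarrow> Sum A B \<sim> Sum A' B'"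

inductive subtype :: "ty \<Rightarrow> ty \<Rightarrow> bool" (infix "<:" 50) where
  "A <: Dyn"
| "Base b <: Base b"
| "C <: A \<Longrightarrow> B <: D \<Longrightarrow> Fun A B <: Fun C D"
| "A <: C \<Longrightarrow> B <: D \<Longrightarrow> Prod A B <: Prod C D"
| "A <: C \<Longrightarrow> B <: D \<Longrightarrow> Sum A B <: Sum C D"

inductive atomic :: "ty \<Rightarrow> bool" where
  "atomic (Base b)"
| "atomic Dyn"


section \<open>Casts and terms\<close>

text \<open>
  \<open>Cast A l B\<close> is a raw cast from \<open>A\<close> to \<open>B\<close> with blame label \<open>l\<close>; the requirement that \<open>A\<close> and
  \<open>B\<close> be consistent is imposed by the typing rules. The type \<open>'l\<close> is the set of blame labels.
\<close>

datatype 'l cast = Cast ty 'l ty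

inductive inert :: "'l cast \<Rightarrow> bool" where
  "A \<noteq> Dyn \<Longrightarrow> inert (Cast A l Dyn)"
| "inert (Cast (Fun A B) l (Fun C D))"
| "inert (Cast (Prod A B) l (Prod C D))"
| "inert (Cast (Sum A B) l (Sum C D))"

text \<open>
  Intrinsically typed terms are represented by raw terms together with a typing judgement. Besides
  constants and injections, also abstractions (by the domain) and \<open>TBlame\<close> (by its type) carry
  a type annotation. This makes types and typing derivations unique, so that well-typed raw terms
  are in bijection with intrinsically typed ones. \<open>TCast M c\<close> stands for \<open>M\<langle>c\<rangle>\<close> and \<open>TWrap M c\<close>
  for \<open>M\<langle>\<langle>c\<rangle>\<rangle>\<close>. \<open>TLam\<close> binds index 0 in its body, and \<open>TCase\<close> in each of its two branches.
\<close>

datatype 'l trm =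
    TConst prim prim_val
  | TVar nat
  | TLam ty "'l trm"
  | TApp "'l trm" "'l trm"
  | TIf "'l trm" "'l trm" "'l trm"
  | TCons "'l trm" "'l trm"
  | TFst "'l trm"
  | TSnd "'l trm"
  | TInl ty "'l trm"
  | TInr ty "'l trm"
  | TCase "'l trm" "'l trm" "'l trm"
  | TCast "'l trm" "'l cast"
  | TWrap "'l trm" "'l cast"
  | TBlame ty 'l

inductive typing :: "ty list \<Rightarrow> 'l trm \<Rightarrow> ty \<Rightarrow> bool" ("_ \<turnstile> _ : _" [51, 51, 51] 50) where
  "k \<in> prim_den P \<Longrightarrow> \<Gamma> \<turnstile> TConst P k : ty_of_prim P"
| "x < length \<Gamma> \<Longrightarrow> \<Gamma> ! x = A \<Longrightarrow> \<Gamma> \<turnstile> TVar x : A"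
| "A # \<Gamma> \<turnstile> M : B \<Longrightarrow> \<Gamma> \<turnstile> TLam A M : Fun A B"
| "\<Gamma> \<turnstile> L : Fun A B \<Longrightarrow> \<Gamma> \<turnstile> M : A \<Longrightarrow> \<Gamma> \<turnstile> TApp L M : B"
| "\<Gamma> \<turnstile> L : Base BBool \<Longrightarrow> \<Gamma> \<turnstile> M : B \<Longrightarrow> \<Gamma> \<turnstile> N : B \<Longrightarrow> \<Gamma> \<turnstile> TIf L M N : B"
| "\<Gamma> \<turnstile> M : A \<Longrightarrow> \<Gamma> \<turnstile> N : B \<Longrightarrow> \<Gamma> \<turnstile> TCons M N : Prod A B"
| "\<Gamma> \<turnstile> M : Prod A B \<Longrightarrow> \<Gamma> \<turnstile> TFst M : A"
| "\<Gamma> \<turnstile> M : Prod A B \<Longrightarrow> \<Gamma> \<turnstile> TSnd M : B"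
| "\<Gamma> \<turnstile> M : A \<Longrightarrow> \<Gamma> \<turnstile> TInl B M : Sum A B"
| "\<Gamma> \<turnstile> M : B \<Longrightarrow> \<Gamma> \<turnstile> TInr A M : Sum A B"
| "\<Gamma> \<turnstile> L : Sum A1 A2 \<Longrightarrow> A1 # \<Gamma> \<turnstile> M : B \<Longrightarrow> A2 # \<Gamma> \<turnstile> N : B \<Longrightarrow> \<Gamma> \<turnstile> TCase L M N : B"
| "\<Gamma> \<turnstile> M : A \<Longrightarrow> A \<sim> B \<Longrightarrow> \<Gamma> \<turnstile> TCast M (Cast A l B) : B"
| "\<Gamma> \<turnstile> M : A \<Longrightarrow> A \<sim> B \<Longrightarrow> inert (Cast A l B) \<Longrightarrow> \<Gamma> \<turnstile> TWrap M (Cast A l B) : B"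
| "\<Gamma> \<turnstile> TBlame A l : A"


section \<open>Substitution\<close>

primrec rename :: "(nat \<Rightarrow> nat) \<Rightarrow> 'l trm \<Rightarrow> 'l trm" where
  "rename \<rho> (TConst P k) = TConst P k"
| "rename \<rho> (TVar x) = TVar (\<rho> x)"
| "rename \<rho> (TLam A M) = TLam A (rename (case_nat 0 (Suc \<circ> \<rho>)) M)"
| "rename \<rho> (TApp L M) = TApp (rename \<rho> L) (rename \<rho> M)"
| "rename \<rho> (TIf L M N) = TIf (rename \<rho> L) (rename \<rho> M) (rename \<rho> N)"
| "rename \<rho> (TCons M N) = TCons (rename \<rho> M) (rename \<rho> N)"
| "rename \<rho> (TFst M) = TFst (rename \<rho> M)"
| "rename \<rho> (TSnd M) = TSnd (rename \<rho> M)"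
| "rename \<rho> (TInl B M) = TInl B (rename \<rho> M)"
| "rename \<rho> (TInr A M) = TInr A (rename \<rho> M)"
| "rename \<rho> (TCase L M N) =
     TCase (rename \<rho> L) (rename (case_nat 0 (Suc \<circ> \<rho>)) M) (rename (case_nat 0 (Suc \<circ> \<rho>)) N)"
| "rename \<rho> (TCast M c) = TCast (rename \<rho> M) c"
| "rename \<rho> (TWrap M c) = TWrap (rename \<rho> M) c"
| "rename \<rho> (TBlame A l) = TBlame A l"

definition exts :: "(nat \<Rightarrow> 'l trm) \<Rightarrow> nat \<Rightarrow> 'l trm" where
  "exts \<sigma> = case_nat (TVar 0) (rename Suc \<circ> \<sigma>)"

primrec subst :: "(nat \<Rightarrow> 'l trm) \<Rightarrow> 'l trm \<Rightarrow> 'l trm" where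
  "subst \<sigma> (TConst P k) = TConst P k"
| "subst \<sigma> (TVar x) = \<sigma> x"
| "subst \<sigma> (TLam A M) = TLam A (subst (exts \<sigma>) M)"
| "subst \<sigma> (TApp L M) = TApp (subst \<sigma> L) (subst \<sigma> M)"
| "subst \<sigma> (TIf L M N) = TIf (subst \<sigma> L) (subst \<sigma> M) (subst \<sigma> N)"
| "subst \<sigma> (TCons M N) = TCons (subst \<sigma> M) (subst \<sigma> N)"
| "subst \<sigma> (TFst M) = TFst (subst \<sigma> M)"
| "subst \<sigma> (TSnd M) = TSnd (subst \<sigma> M)"
| "subst \<sigma> (TInl B M) = TInl B (subst \<sigma> M)"
| "subst \<sigma> (TInr A M) = TInr A (subst \<sigma> M)"
| "subst \<sigma> (TCase L M N) = TCase (subst \<sigma> L) (subst (exts \<sigma>) M) (subst (exts \<sigma>) N)"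
| "subst \<sigma> (TCast M c) = TCast (subst \<sigma> M) c"
| "subst \<sigma> (TWrap M c) = TWrap (subst \<sigma> M) c"
| "subst \<sigma> (TBlame A l) = TBlame A l"

definition subst0 :: "'l trm \<Rightarrow> 'l trm \<Rightarrow> 'l trm" where
  "subst0 M N = subst (case_nat N TVar) M"

text \<open>
  \<open>cast_bound M c\<close> replaces the variable 0 of \<open>M\<close>, of the target type of \<open>c\<close>, by the cast
  \<open>c\<close> applied to a variable 0 of the source type of \<open>c\<close>; all other variables are unchanged.
\<close>

definition cast_bound :: "'l trm \<Rightarrow> 'l cast \<Rightarrow> 'l trm" where
  "cast_bound M c = subst (case_nat (TCast (TVar 0) c) (TVar \<circ> Suc)) M"


section \<open>Reduction\<close>

inductive is_val :: "'l trm \<Rightarrow> bool" where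
  "is_val (TLam A M)"
| "is_val (TConst P k)"
| "is_val V \<Longrightarrow> is_val W \<Longrightarrow> is_val (TCons V W)"
| "is_val V \<Longrightarrow> is_val (TInl B V)"
| "is_val V \<Longrightarrow> is_val (TInr A V)"
| "is_val V \<Longrightarrow> is_val (TWrap V c)"

inductive frame :: "('l trm \<Rightarrow> 'l trm) \<Rightarrow> bool" where
  "frame (\<lambda>X. TApp X M)"
| "is_val V \<Longrightarrow> frame (\<lambda>X. TApp V X)"
| "frame (\<lambda>X. TIf X M N)"
| "is_val V \<Longrightarrow> frame (\<lambda>X. TCons V X)"
| "frame (\<lambda>X. TCons X N)"
| "frame (\<lambda>X. TFst X)"
| "frame (\<lambda>X. TSnd X)"
| "frame (\<lambda>X. TInl B X)"
| "frame (\<lambda>X. TInr A X)"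
| "frame (\<lambda>X. TCase X M N)"
| "frame (\<lambda>X. TCast X c)"
| "frame (\<lambda>X. TWrap X c)"

text \<open>
  The context \<open>\<Gamma>\<close> and the typing premise of \<open>frame_blame\<close> only serve to determine the type
  annotation of the resulting \<open>TBlame\<close>. Restricted to well-typed terms, \<open>step \<Gamma>\<close> is the reduction
  relation on intrinsically typed terms in context \<open>\<Gamma>\<close>.
\<close>

inductive step :: "ty list \<Rightarrow> 'l trm \<Rightarrow> 'l trm \<Rightarrow> bool" ("_ \<turnstile> _ \<longmapsto> _" [51, 51, 51] 50)
  for \<Gamma> :: "ty list" where
  frame_step: "frame F \<Longrightarrow> \<Gamma> \<turnstile> M \<longmapsto> M' \<Longrightarrow> \<Gamma> \<turnstile> F M \<longmapsto> F M'"
| frame_blame: "frame F \<Longrightarrow> \<Gamma> \<turnstile> F (TBlame A l) : B \<Longrightarrow> \<Gamma> \<turnstile> F (TBlame A l) \<longmapsto> TBlame B l"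
| cast_inert: "is_val V \<Longrightarrow> inert c \<Longrightarrow> \<Gamma> \<turnstile> TCast V c \<longmapsto> TWrap V c"
| cast_id: "is_val V \<Longrightarrow> atomic a \<Longrightarrow> \<Gamma> \<turnstile> TCast V (Cast a l a) \<longmapsto> V"
| cast_proj: "is_val V \<Longrightarrow> B \<noteq> Dyn \<Longrightarrow> A \<sim> B \<Longrightarrow>
    \<Gamma> \<turnstile> TCast (TWrap V (Cast A l1 Dyn)) (Cast Dyn l2 B) \<longmapsto> TCast V (Cast A l2 B)"
| cast_fail: "is_val V \<Longrightarrow> B \<noteq> Dyn \<Longrightarrow> \<not> A \<sim> B \<Longrightarrow>
    \<Gamma> \<turnstile> TCast (TWrap V (Cast A l1 Dyn)) (Cast Dyn l2 B) \<longmapsto> TBlame B l2"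
| wrap_app: "is_val V \<Longrightarrow> is_val W \<Longrightarrow>
    \<Gamma> \<turnstile> TApp (TWrap V (Cast (Fun A B) l (Fun C D))) W
      \<longmapsto> TCast (TApp V (TCast W (Cast C l A))) (Cast B l D)"
| wrap_fst: "is_val V \<Longrightarrow>
    \<Gamma> \<turnstile> TFst (TWrap V (Cast (Prod A B) l (Prod C D))) \<longmapsto> TCast (TFst V) (Cast A l C)"
| wrap_snd: "is_val V \<Longrightarrow>
    \<Gamma> \<turnstile> TSnd (TWrap V (Cast (Prod A B) l (Prod C D))) \<longmapsto> TCast (TSnd V) (Cast B l D)"
| wrap_case: "is_val V \<Longrightarrow>
    \<Gamma> \<turnstile> TCase (TWrap V (Cast (Sum A B) l (Sum C D))) M N
      \<longmapsto> TCase V (cast_bound M (Cast A l C)) (cast_bound N (Cast B l D))"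
| beta: "is_val V \<Longrightarrow> \<Gamma> \<turnstile> TApp (TLam A M) V \<longmapsto> subst0 M V"
| if_true: "\<Gamma> \<turnstile> TIf (TConst (PBase BBool) (BaseV (BoolV True))) M N \<longmapsto> M"
| if_false: "\<Gamma> \<turnstile> TIf (TConst (PBase BBool) (BaseV (BoolV False))) M N \<longmapsto> N"
| fst_cons: "is_val V \<Longrightarrow> is_val W \<Longrightarrow> \<Gamma> \<turnstile> TFst (TCons V W) \<longmapsto> V"
| snd_cons: "is_val V \<Longrightarrow> is_val W \<Longrightarrow> \<Gamma> \<turnstile> TSnd (TCons V W) \<longmapsto> W"
| case_inl: "is_val V \<Longrightarrow> \<Gamma> \<turnstile> TCase (TInl B V) M N \<longmapsto> subst0 M V"
| case_inr: "is_val V \<Longrightarrow> \<Gamma> \<turnstile> TCase (TInr A V) M N \<longmapsto> subst0 N V"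
| delta: "\<Gamma> \<turnstile> TApp (TConst (PFun b P) (FunV f)) (TConst (PBase b) (BaseV v)) \<longmapsto> TConst P (f v)"

abbreviation steps :: "ty list \<Rightarrow> 'l trm \<Rightarrow> 'l trm \<Rightarrow> bool" ("_ \<turnstile> _ \<longmapsto>* _" [51, 51, 51] 50) where
  "\<Gamma> \<turnstile> M \<longmapsto>* N \<equiv> (step \<Gamma>)\<^sup>*\<^sup>* M N"


section \<open>Blame safety\<close>

primrec cast_blame_safe :: "'l cast \<Rightarrow> 'l \<Rightarrow> bool" where
  "cast_blame_safe (Cast A l' B) l \<longleftrightarrow> l' \<noteq> l \<or> A <: B"

primrec subterms :: "'l trm \<Rightarrow> 'l trm set" where
  "subterms (TConst P k) = {TConst P k}"
| "subterms (TVar x) = {TVar x}"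
| "subterms (TLam A M) = insert (TLam A M) (subterms M)"
| "subterms (TApp L M) = insert (TApp L M) (subterms L \<union> subterms M)"
| "subterms (TIf L M N) = insert (TIf L M N) (subterms L \<union> subterms M \<union> subterms N)"
| "subterms (TCons M N) = insert (TCons M N) (subterms M \<union> subterms N)"
| "subterms (TFst M) = insert (TFst M) (subterms M)"
| "subterms (TSnd M) = insert (TSnd M) (subterms M)"
| "subterms (TInl B M) = insert (TInl B M) (subterms M)"
| "subterms (TInr A M) = insert (TInr A M) (subterms M)"
| "subterms (TCase L M N) = insert (TCase L M N) (subterms L \<union> subterms M \<union> subterms N)"
| "subterms (TCast M c) = insert (TCast M c) (subterms M)"
| "subterms (TWrap M c) = insert (TWrap M c) (subterms M)"
| "subterms (TBlame A l) = {TBlame A l}"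

definition safe_for :: "'l trm \<Rightarrow> 'l \<Rightarrow> bool" where
  "safe_for M l \<longleftrightarrow>
     (\<forall>N c. TCast N c \<in> subterms M \<or> TWrap N c \<in> subterms M \<longrightarrow> cast_blame_safe c l) \<and>
     (\<forall>A l'. TBlame A l' \<in> subterms M \<longrightarrow> l' \<noteq> l)"

end

(* Safety for a label is preserved by reduction, on untyped raw terms already, and a term safe for l
   is not blame l. Structural casts are split into casts between components, which are again
   subtype casts. A projection from the dynamic type to B \<noteq> Dyn is never a subtype cast, so in a safe
   term its label differs from l; hence neither the collapsed cast nor the blame it may raise is
   for l. *)

theory Submission
  imports Defs
begin

lemma safe_for_simps [simp]:
  "safe_for (TConst P k) l"
  "safe_for (TVar x) l"
  "safe_for (TLam A M) l \<longleftrightarrow> safe_for M l"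
  "safe_for (TApp L M) l \<longleftrightarrow> safe_for L l \<and> safe_for M l"
  "safe_for (TIf L M N) l \<longleftrightarrow> safe_for L l \<and> safe_for M l \<and> safe_for N l"
  "safe_for (TCons M N) l \<longleftrightarrow> safe_for M l \<and> safe_for N l"
  "safe_for (TFst M) l \<longleftrightarrow> safe_for M l"
  "safe_for (TSnd M) l \<longleftrightarrow> safe_for M l"
  "safe_for (TInl B M) l \<longleftrightarrow> safe_for M l"
  "safe_for (TInr A M) l \<longleftrightarrow> safe_for M l"
  "safe_for (TCase L M N) l \<longleftrightarrow> safe_for L l \<and> safe_for M l \<and> safe_for N l"
  "safe_for (TCast M c) l \<longleftrightarrow> safe_for M l \<and> cast_blame_safe c l"
  "safe_for (TWrap M c) l \<longleftrightarrow> safe_for M l \<and> cast_blame_safe c l"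
  "safe_for (TBlame A l') l \<longleftrightarrow> l' \<noteq> l"
  unfolding safe_for_def by auto

text \<open>Inversion by head constructor. The contravariant domain condition \<open>C <: A\<close>
  is what the argument cast from \<open>C\<close> to \<open>A\<close> in \<open>wrap_app\<close>
  requires.\<close>

lemma subtype_simps [simp]:
  "Dyn <: B \<longleftrightarrow> B = Dyn"
  "Fun A B <: Fun C D \<longleftrightarrow> C <: A \<and> B <: D"
  "Prod A B <: Prod C D \<longleftrightarrow> A <: C \<and> B <: D"
  "Sum A B <: Sum C D \<longleftrightarrow> A <: C \<and> B <: D"
  by (auto elim: subtype.cases intro: subtype.intros)

lemma safe_for_rename [simp]: "safe_for (rename \<rho> M) l \<longleftrightarrow> safe_for M l"
  by (induction M arbitrary: \<rho>) auto

lemma safe_for_exts: "(\<And>x. safe_for (\<sigma> x) l) \<Longrightarrow> safe_for (exts \<sigma> x) l"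
  by (simp add: exts_def split: nat.split)

text \<open>Every cast or blame in the result stems from \<open>M\<close> or from some
  \<open>\<sigma> x\<close>. Generalizing \<open>\<sigma>\<close> lets the induction pass to
  \<open>exts \<sigma>\<close> under binders.\<close>

lemma safe_for_subst:
  "safe_for M l \<Longrightarrow> (\<And>x. safe_for (\<sigma> x) l) \<Longrightarrow> safe_for (subst \<sigma> M) l"
  by (induction M arbitrary: \<sigma>) (simp_all add: safe_for_exts)

lemma safe_for_subst0: "safe_for M l \<Longrightarrow> safe_for N l \<Longrightarrow> safe_for (subst0 M N) l"
  unfolding subst0_def by (rule safe_for_subst) (auto split: nat.split)

text \<open>The only cast that can be added is \<open>c\<close>, around variable 0.\<close>

lemma safe_for_cast_bound:
  "safe_for M l \<Longrightarrow> cast_blame_safe c l \<Longrightarrow> safe_for (cast_bound M c) l"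
  unfolding cast_bound_def by (rule safe_for_subst) (auto split: nat.split)

lemma frame_safe_for: "frame F \<Longrightarrow> safe_for (F M) l \<Longrightarrow> safe_for M l"
  by (induction rule: frame.induct) auto

text \<open>Safety is checked node by node, so the content of the hole can be exchanged
  independently of the frame.\<close>

lemma frame_safe_for_replace:
  "frame F \<Longrightarrow> safe_for (F M) l \<Longrightarrow> safe_for N l \<Longrightarrow> safe_for (F N) l"
  by (induction rule: frame.induct) auto

lemma step_safe_for: "\<Gamma> \<turnstile> M \<longmapsto> N \<Longrightarrow> safe_for M l \<Longrightarrow> safe_for N l"
proof (induction rule: step.induct)
  case frame_step
  then show ?case by (blast intro: frame_safe_for frame_safe_for_replace)
next
  case frame_blame
  \<comment> \<open>Blame leaves the frame with its label unchanged.\<close>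
  then show ?case by (auto dest: frame_safe_for)
qed (auto intro: safe_for_subst0 safe_for_cast_bound)

lemma steps_safe_for: "\<Gamma> \<turnstile> M \<longmapsto>* N \<Longrightarrow> safe_for M l \<Longrightarrow> safe_for N l"
  by (induction rule: rtranclp_induct) (auto intro: step_safe_for)

theorem corollary43:
  fixes \<Gamma> :: "ty list" and M :: "'l trm" and A :: ty and l :: 'l
  assumes "\<Gamma> \<turnstile> M : A"
    and "safe_for M l"
  shows "\<not> \<Gamma> \<turnstile> M \<longmapsto>* TBlame A l"
  \<comment> \<open>\<open>TBlame A l\<close> is not safe for \<open>l\<close>, so reaching it would
    contradict preservation.\<close>
  using steps_safe_for assms(2) by fastforce

end
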